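(* The principal 3D slice $\mathcal{T}(\mathbf{j_1},\mathbf{j_2},\mathbf{j_3})$ of the tricomplex Mandelbrot set (the Firebrot) is a regular tetrahedron with edge length $\frac{\sqrt{2}}{2}$.
   Context: The tricomplex numbers $\mathbb{TC}$ form the commutative, associative unital real algebra generated by three commuting elements $\mathbf{i_1},\mathbf{i_2},\mathbf{i_3}$ with $\mathbf{i_1}^2=\mathbf{i_2}^2=\mathbf{i_3}^2=-1$; it has dimension 8 over $\mathbb{R}$ with basis $1,\mathbf{i_1},\mathbf{i_2},\mathbf{j_1},\mathbf{i_3},\mathbf{j_2},\mathbf{j_3},\mathbf{i_4}$, where $\mathbf{j_1}=\mathbf{i_1}\mathbf{i_2}$, $\mathbf{j_2}=\mathbf{i_1}\mathbf{i_3}$, $\mathbf{j_3}=\mathbf{i_2}\mathbf{i_3}$ and $\mathbf{i_4}=\mathbf{i_1}\mathbf{i_2}\mathbf{i_3}$. Boundedness in $\mathbb{TC}\cong\mathbb{R}^8$ is with respect to the Euclidean norm. For $c\in\mathbb{TC}$ let $P_c(\eta)=\eta^2+c$ and let $P_c^{(n)}$ be its $n$-fold composition. The tricomplex Mandelbrot set is $\mathcal{M}_3=\{c\in\mathbb{TC}:\{P_c^{(n)}(0)\}_{n\in\mathbb{N}}\text{ is bounded}\}$. The slice is $\mathcal{T}(\mathbf{j_1},\mathbf{j_2},\mathbf{j_3})=\mathrm{span}_{\mathbb{R}}\{\mathbf{j_1},\mathbf{j_2},\mathbf{j_3}\}\cap\mathcal{M}_3$. The space $\mathrm{span}_{\mathbb{R}}\{\mathbf{j_1},\mathbf{j_2},\mathbf{j_3}\}$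 is identified with Euclidean $\mathbb{R}^3$ via $c_4\mathbf{j_1}+c_6\mathbf{j_2}+c_7\mathbf{j_3}\mapsto(c_4,c_6,c_7)$; "tetrahedron" means the solid (convex hull of its four vertices). *)

theory Defs
  imports "HOL-Analysis.Analysis"
begin

(* The components of a tricomplex number are its coordinates with respect to
   1, i1, i2, j1 = i1 i2, i3, j2 = i1 i3, j3 = i2 i3, i4 = i1 i2 i3, in this order.
   If the k-th of these is indexed by the set A of generators occurring in it, then
   e_A e_B = (-1)^|A Int B| e_(A symmetric difference B); the formulas for the product
   below are the bilinear extension of this rule. *)

codatatype tricomplex =
  Tricomplex (tc1: real) (tc2: real) (tc3: real) (tc4: real) (tc5: real) (tc6: real) (tc7: real) (tc8: real)

lemma tricomplex_eqI:
  "\<lbrakk>tc1 x = tc1 y; tc2 x = tc2 y; tc3 x = tc3 y; tc4 x = tc4 y; tc5 x = tc5 y; tc6 x = tc6 y; tc7 x = tc7 y; tc8 x = tc8 y\<rbrakk> \<Longrightarrow> x = y"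
  by (rule tricomplex.expand) simp

lemma tricomplex_eq_iff:
  "x = y \<longleftrightarrow> tc1 x = tc1 y \<and> tc2 x = tc2 y \<and> tc3 x = tc3 y \<and> tc4 x = tc4 y \<and> tc5 x = tc5 y \<and> tc6 x = tc6 y \<and> tc7 x = tc7 y \<and> tc8 x = tc8 y"
  by (auto intro: tricomplex_eqI)

instantiation tricomplex :: comm_ring_1
begin

primcorec zero_tricomplex :: "tricomplex" where
    "tc1 0 = 0"
  | "tc2 0 = 0"
  | "tc3 0 = 0"
  | "tc4 0 = 0"
  | "tc5 0 = 0"
  | "tc6 0 = 0"
  | "tc7 0 = 0"
  | "tc8 0 = 0"

primcorec one_tricomplex :: "tricomplex" where
    "tc1 1 = 1"
  | "tc2 1 = 0"
  | "tc3 1 = 0"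
  | "tc4 1 = 0"
  | "tc5 1 = 0"
  | "tc6 1 = 0"
  | "tc7 1 = 0"
  | "tc8 1 = 0"

primcorec plus_tricomplex :: "tricomplex \<Rightarrow> tricomplex \<Rightarrow> tricomplex" where
    "tc1 (x + y) = tc1 x + tc1 y"
  | "tc2 (x + y) = tc2 x + tc2 y"
  | "tc3 (x + y) = tc3 x + tc3 y"
  | "tc4 (x + y) = tc4 x + tc4 y"
  | "tc5 (x + y) = tc5 x + tc5 y"
  | "tc6 (x + y) = tc6 x + tc6 y"
  | "tc7 (x + y) = tc7 x + tc7 y"
  | "tc8 (x + y) = tc8 x + tc8 y"

primcorec uminus_tricomplex :: "tricomplex \<Rightarrow> tricomplex" where
    "tc1 (- x) = - tc1 x"
  | "tc2 (- x) = - tc2 x"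
  | "tc3 (- x) = - tc3 x"
  | "tc4 (- x) = - tc4 x"
  | "tc5 (- x) = - tc5 x"
  | "tc6 (- x) = - tc6 x"
  | "tc7 (- x) = - tc7 x"
  | "tc8 (- x) = - tc8 x"

primcorec minus_tricomplex :: "tricomplex \<Rightarrow> tricomplex \<Rightarrow> tricomplex" where
    "tc1 (x - y) = tc1 x - tc1 y"
  | "tc2 (x - y) = tc2 x - tc2 y"
  | "tc3 (x - y) = tc3 x - tc3 y"
  | "tc4 (x - y) = tc4 x - tc4 y"
  | "tc5 (x - y) = tc5 x - tc5 y"
  | "tc6 (x - y) = tc6 x - tc6 y"
  | "tc7 (x - y) = tc7 x - tc7 y"
  | "tc8 (x - y) = tc8 x - tc8 y"

primcorec times_tricomplex :: "tricomplex \<Rightarrow> tricomplex \<Rightarrow> tricomplex" where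
    "tc1 (x * y) =
       tc1 x * tc1 y - tc2 x * tc2 y - tc3 x * tc3 y + tc4 x * tc4 y - tc5 x * tc5 y + tc6 x * tc6 y + tc7 x * tc7 y - tc8 x * tc8 y"
  | "tc2 (x * y) =
       tc1 x * tc2 y + tc2 x * tc1 y - tc3 x * tc4 y - tc4 x * tc3 y - tc5 x * tc6 y - tc6 x * tc5 y + tc7 x * tc8 y + tc8 x * tc7 y"
  | "tc3 (x * y) =
       tc1 x * tc3 y - tc2 x * tc4 y + tc3 x * tc1 y - tc4 x * tc2 y - tc5 x * tc7 y + tc6 x * tc8 y - tc7 x * tc5 y + tc8 x * tc6 y"
  | "tc4 (x * y) =
       tc1 x * tc4 y + tc2 x * tc3 y + tc3 x * tc2 y + tc4 x * tc1 y - tc5 x * tc8 y - tc6 x * tc7 y - tc7 x * tc6 y - tc8 x * tc5 y"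
  | "tc5 (x * y) =
       tc1 x * tc5 y - tc2 x * tc6 y - tc3 x * tc7 y + tc4 x * tc8 y + tc5 x * tc1 y - tc6 x * tc2 y - tc7 x * tc3 y + tc8 x * tc4 y"
  | "tc6 (x * y) =
       tc1 x * tc6 y + tc2 x * tc5 y - tc3 x * tc8 y - tc4 x * tc7 y + tc5 x * tc2 y + tc6 x * tc1 y - tc7 x * tc4 y - tc8 x * tc3 y"
  | "tc7 (x * y) =
       tc1 x * tc7 y - tc2 x * tc8 y + tc3 x * tc5 y - tc4 x * tc6 y + tc5 x * tc3 y - tc6 x * tc4 y + tc7 x * tc1 y - tc8 x * tc2 y"
  | "tc8 (x * y) =
       tc1 x * tc8 y + tc2 x * tc7 y + tc3 x * tc6 y + tc4 x * tc5 y + tc5 x * tc4 y + tc6 x * tc3 y + tc7 x * tc2 y + tc8 x * tc1 y"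

instance
proof
  fix x y z :: tricomplex
  show "x * y * z = x * (y * z)"
    by (rule tricomplex_eqI; simp only: times_tricomplex.sel; algebra)
  show "x * y = y * x"
    by (rule tricomplex_eqI; simp only: times_tricomplex.sel; algebra)
  show "(x + y) * z = x * z + y * z"
    by (rule tricomplex_eqI; simp only: times_tricomplex.sel plus_tricomplex.sel; algebra)
qed (simp_all add: tricomplex_eq_iff)

end

instantiation tricomplex :: real_algebra_1
begin

primcorec scaleR_tricomplex :: "real \<Rightarrow> tricomplex \<Rightarrow> tricomplex" where
    "tc1 (a *\<^sub>R x) = a * tc1 x"
  | "tc2 (a *\<^sub>R x) = a * tc2 x"
  | "tc3 (a *\<^sub>R x) = a * tc3 x"
  | "tc4 (a *\<^sub>R x) = a * tc4 x"
  | "tc5 (a *\<^sub>R x) = a * tc5 x"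
  | "tc6 (a *\<^sub>R x) = a * tc6 x"
  | "tc7 (a *\<^sub>R x) = a * tc7 x"
  | "tc8 (a *\<^sub>R x) = a * tc8 x"

instance
proof
  fix a :: real and x y :: tricomplex
  show "a *\<^sub>R x * y = a *\<^sub>R (x * y)" "x * a *\<^sub>R y = a *\<^sub>R (x * y)"
    by (rule tricomplex_eqI; simp only: times_tricomplex.sel scaleR_tricomplex.sel; algebra)+
qed (simp_all add: tricomplex_eq_iff algebra_simps)

end

instantiation tricomplex :: real_inner
begin

definition inner_tricomplex :: "tricomplex \<Rightarrow> tricomplex \<Rightarrow> real" where
  "inner_tricomplex x y =
     tc1 x * tc1 y + tc2 x * tc2 y + tc3 x * tc3 y + tc4 x * tc4 y + tc5 x * tc5 y + tc6 x * tc6 y + tc7 x * tc7 y + tc8 x * tc8 y"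

definition norm_tricomplex :: "tricomplex \<Rightarrow> real" where
  "norm_tricomplex x = sqrt (inner x x)"

definition sgn_tricomplex :: "tricomplex \<Rightarrow> tricomplex" where
  "sgn_tricomplex x = x /\<^sub>R norm x"

definition dist_tricomplex :: "tricomplex \<Rightarrow> tricomplex \<Rightarrow> real" where
  "dist_tricomplex x y = norm (x - y)"

definition uniformity_tricomplex :: "(tricomplex \<times> tricomplex) filter" where
  "uniformity_tricomplex = (INF e\<in>{0<..}. principal {(x, y). dist x y < e})"

definition open_tricomplex :: "tricomplex set \<Rightarrow> bool" where
  "open_tricomplex U \<longleftrightarrow> (\<forall>x\<in>U. eventually (\<lambda>(x', y). x' = x \<longrightarrow> y \<in> U) uniformity)"

instance
proof
  fix x y z :: tricomplex and a :: real
  show "inner x y = inner y x"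
    by (simp add: inner_tricomplex_def mult.commute)
  show "inner (x + y) z = inner x z + inner y z" "inner (a *\<^sub>R x) y = a * inner x y"
    by (simp_all add: inner_tricomplex_def algebra_simps)
  show "0 \<le> inner x x"
    by (simp add: inner_tricomplex_def)
  show "inner x x = 0 \<longleftrightarrow> x = 0"
    by (simp add: inner_tricomplex_def tricomplex_eq_iff add_nonneg_eq_0_iff)
qed (fact norm_tricomplex_def sgn_tricomplex_def dist_tricomplex_def
      uniformity_tricomplex_def open_tricomplex_def)+

end

definition i1 :: tricomplex where "i1 = Tricomplex 0 1 0 0 0 0 0 0"
definition i2 :: tricomplex where "i2 = Tricomplex 0 0 1 0 0 0 0 0"
definition i3 :: tricomplex where "i3 = Tricomplex 0 0 0 0 1 0 0 0"
definition j1 :: tricomplex where "j1 = i1 * i2"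
definition j2 :: tricomplex where "j2 = i1 * i3"
definition j3 :: tricomplex where "j3 = i2 * i3"
definition i4 :: tricomplex where "i4 = i1 * i2 * i3"

lemma generator_squares: "i1\<^sup>2 = -1" "i2\<^sup>2 = -1" "i3\<^sup>2 = -1"
  by (simp_all add: power2_eq_square tricomplex_eq_iff i1_def i2_def i3_def)

lemma j1_eq: "j1 = Tricomplex 0 0 0 1 0 0 0 0"
  by (simp add: j1_def i1_def i2_def i3_def tricomplex_eq_iff)
lemma j2_eq: "j2 = Tricomplex 0 0 0 0 0 1 0 0"
  by (simp add: j2_def i1_def i2_def i3_def tricomplex_eq_iff)
lemma j3_eq: "j3 = Tricomplex 0 0 0 0 0 0 1 0"
  by (simp add: j3_def i1_def i2_def i3_def tricomplex_eq_iff)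
lemma i4_eq: "i4 = Tricomplex 0 0 0 0 0 0 0 1"
  by (simp add: i4_def i1_def i2_def i3_def tricomplex_eq_iff)

lemmas tricomplex_units = i1_def i2_def i3_def j1_eq j2_eq j3_eq i4_eq

lemma tricomplex_expansion:
  "Tricomplex a1 a2 a3 a4 a5 a6 a7 a8 =
     a1 *\<^sub>R 1 + a2 *\<^sub>R i1 + a3 *\<^sub>R i2 + a4 *\<^sub>R j1 + a5 *\<^sub>R i3 + a6 *\<^sub>R j2 + a7 *\<^sub>R j3 + a8 *\<^sub>R i4"
  by (simp add: tricomplex_eq_iff tricomplex_units)

instantiation tricomplex :: euclidean_space
begin

definition Basis_tricomplex :: "tricomplex set" where
  "Basis_tricomplex = {1, i1, i2, j1, i3, j2, j3, i4}"

instance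
proof
  fix u v x :: tricomplex
  show "(Basis :: tricomplex set) \<noteq> {}" "finite (Basis :: tricomplex set)"
    by (simp_all add: Basis_tricomplex_def)
  show "inner u v = (if u = v then 1 else 0)" if "u \<in> Basis" "v \<in> Basis"
    using that unfolding Basis_tricomplex_def
    by (elim insertE emptyE; hypsubst)
      (simp_all add: inner_tricomplex_def tricomplex_units tricomplex_eq_iff)
  show "(\<forall>u\<in>Basis. inner x u = 0) \<longleftrightarrow> x = 0"
    unfolding tricomplex_eq_iff[of x 0]
    by (simp add: Basis_tricomplex_def inner_tricomplex_def tricomplex_units)
qed

end

lemma DIM_tricomplex: "DIM(tricomplex) = 8"
  by (simp add: Basis_tricomplex_def tricomplex_units tricomplex_eq_iff)

definition tricomplex_mandelbrot :: "tricomplex set" where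
  "tricomplex_mandelbrot = {c. bounded (range (\<lambda>n. ((\<lambda>\<eta>. \<eta>\<^sup>2 + c) ^^ n) 0))}"

definition principal_slice :: "tricomplex \<Rightarrow> tricomplex \<Rightarrow> tricomplex \<Rightarrow> tricomplex set" where
  "principal_slice a b c = span {a, b, c} \<inter> tricomplex_mandelbrot"

(* Used only on the span of j1, j2, j3, where it is a bijection onto real^3. *)
definition j_coords :: "tricomplex \<Rightarrow> real ^ 3" where
  "j_coords x = vector [tc4 x, tc6 x, tc7 x]"

lemma j_coords_linear_combination:
  "j_coords (c4 *\<^sub>R j1 + c6 *\<^sub>R j2 + c7 *\<^sub>R j3) = vector [c4, c6, c7]"
  by (simp add: j_coords_def tricomplex_units)

definition regular_tetrahedron :: "real \<Rightarrow> (real ^ 3) set \<Rightarrow> bool" where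
  "regular_tetrahedron s S \<longleftrightarrow>
     (\<exists>V. card V = 4 \<and> \<not> affine_dependent V \<and> S = convex hull V \<and>
          (\<forall>x\<in>V. \<forall>y\<in>V. x \<noteq> y \<longrightarrow> dist x y = s))"

end

theory Submission
  imports Defs
begin

text \<open>
  The units \<^term>\<open>j1\<close>, \<^term>\<open>j2\<close>, \<^term>\<open>j3\<close> are hyperbolic: they square to \<open>1\<close>, and
  \<open>j1 j2 = - j3\<close>. Hence their span together with \<open>1\<close> is a real algebra isomorphic to
  \<open>\<real> \<times> \<real> \<times> \<real> \<times> \<real>\<close>. Its four projections to \<open>\<real>\<close> are the characters sending \<open>(j1, j2, j3)\<close> to
  \<open>(- a, - b, - c)\<close> with signs \<open>a b c = 1\<close>. These sign vectors, divided by \<open>4\<close>, are the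
  vertices \<open>v\<close> of a regular tetrahedron centred at the origin, so the characters are
  \<open>x \<mapsto> tc1 x - 4 (v \<bullet> j_coords x)\<close>, one for each vertex.

  Since each character is multiplicative, it carries the orbit of \<open>0\<close> under \<open>\<eta>\<^sup>2 + c\<close> to the orbit
  of \<open>0\<close> under a real quadratic map, and the former is bounded iff its four images are. A real
  map \<open>x\<^sup>2 + r\<close> has bounded critical orbit iff \<open>- 2 \<le> r \<le> 1/4\<close>. For \<open>c\<close> in the span of the
  three units with coordinates \<open>p\<close>, the four parameters are \<open>r = - 4 (v \<bullet> p)\<close>. They add up to
  \<open>0\<close>, so once all are at most \<open>1/4\<close> all are at least \<open>- 3/4\<close>, and the lower bound never cuts
  anything off. What remains are the four half-spaces \<open>v \<bullet> p \<ge> - 1/16\<close>, and these bound exactly the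
  tetrahedron with vertices \<open>v\<close>: the barycentric coordinates of \<open>p\<close> are \<open>1/4 + 4 (v \<bullet> p)\<close>.
\<close>

section \<open>Critical orbits of real quadratic maps\<close>

text \<open>
  The larger fixed point \<open>b\<close> of \<open>x\<^sup>2 + r\<close> exists because \<open>r \<le> 1/4\<close>, and the interval \<open>[- b, b]\<close> is
  mapped into itself because \<open>- b \<le> r\<close>, which is where \<open>- 2 \<le> r\<close> enters.
\<close>

lemma real_quadratic_orbit_bounded:
  fixes r :: real
  assumes "- 2 \<le> r" "r \<le> 1 / 4"
  shows "bounded (range (\<lambda>n. ((\<lambda>x. x\<^sup>2 + r) ^^ n) 0))"
proof -
  define b where "b = (1 + sqrt (1 - 4 * r)) / 2"
  have sq: "(sqrt (1 - 4 * r))\<^sup>2 = 1 - 4 * r"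
    using assms by simp
  have fixed: "b\<^sup>2 + r = b"
    unfolding b_def using sq by (simp add: field_simps power2_eq_square)
  have "sqrt (1 - 4 * r) \<le> 3"
    using assms by (intro real_le_lsqrt) auto
  then have "b \<le> 2"
    by (simp add: b_def)
  have "0 \<le> b"
    using assms by (simp add: b_def)
  have "0 \<le> b * (2 - b)"
    using \<open>0 \<le> b\<close> \<open>b \<le> 2\<close> by simp
  then have "- b \<le> r"
    using fixed by (simp add: algebra_simps power2_eq_square)
  have "\<bar>((\<lambda>x. x\<^sup>2 + r) ^^ n) 0\<bar> \<le> b" for n
  proof (induction n)
    case 0
    show ?case
      using \<open>0 \<le> b\<close> by simp
  next
    case (Suc n)
    have "(((\<lambda>x. x\<^sup>2 + r) ^^ n) 0)\<^sup>2 \<le> b\<^sup>2"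
      using power_mono[OF Suc abs_ge_zero, of 2] by simp
    moreover have "0 \<le> (((\<lambda>x. x\<^sup>2 + r) ^^ n) 0)\<^sup>2"
      by simp
    ultimately have "- b \<le> (((\<lambda>x. x\<^sup>2 + r) ^^ n) 0)\<^sup>2 + r"
      "(((\<lambda>x. x\<^sup>2 + r) ^^ n) 0)\<^sup>2 + r \<le> b"
      using fixed \<open>- b \<le> r\<close> by linarith+
    then show ?case
      by (simp add: abs_le_iff)
  qed
  then show ?thesis
    by (auto simp: bounded_iff)
qed

text \<open>
  Each step increases the orbit by at least \<open>r - 1/4\<close>, because
  \<open>x\<^sup>2 + r - x = (x - 1/2)\<^sup>2 + (r - 1/4)\<close>.
\<close>

lemma real_quadratic_orbit_unbounded:
  fixes r :: real
  assumes "1 / 4 < r"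
  shows "\<not> bounded (range (\<lambda>n. ((\<lambda>x. x\<^sup>2 + r) ^^ n) 0))"
proof
  have growth: "real n * (r - 1 / 4) \<le> ((\<lambda>x. x\<^sup>2 + r) ^^ n) 0" for n
  proof (induction n)
    case (Suc n)
    let ?x = "((\<lambda>x. x\<^sup>2 + r) ^^ n) 0"
    have "0 \<le> (?x - 1 / 2)\<^sup>2"
      by simp
    also have "\<dots> = ?x\<^sup>2 - ?x + 1 / 4"
      by (simp add: power2_eq_square algebra_simps)
    finally show ?case
      using Suc by (simp add: algebra_simps add_divide_distrib)
  qed simp
  assume "bounded (range (\<lambda>n. ((\<lambda>x. x\<^sup>2 + r) ^^ n) 0))"
  then obtain B where B: "\<And>n. \<bar>((\<lambda>x. x\<^sup>2 + r) ^^ n) 0\<bar> \<le> B"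
    by (auto simp: bounded_iff)
  obtain n where "B < real n * (r - 1 / 4)"
    using assms reals_Archimedean3[of "r - 1 / 4"] by auto
  with growth[of n] B[of n] show False
    by linarith
qed

section \<open>A regular tetrahedron centred at the origin\<close>

definition firebrot_vertices :: "(real ^ 3) set" where
  "firebrot_vertices =
     {vector [1/4, 1/4, 1/4], vector [1/4, -1/4, -1/4],
      vector [-1/4, 1/4, -1/4], vector [-1/4, -1/4, 1/4]}"

lemma inner_real_3: "(x :: real ^ 3) \<bullet> y = x $ 1 * y $ 1 + x $ 2 * y $ 2 + x $ 3 * y $ 3"
  by (simp add: inner_vec_def sum_3)

lemma vector_3_eq_iff:
  "(vector [a, b, c] :: real ^ 3) = vector [a', b', c'] \<longleftrightarrow> a = a' \<and> b = b' \<and> c = c'"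
  by (auto simp: vec_eq_iff forall_3)

lemma finite_firebrot_vertices: "finite firebrot_vertices"
  by (simp add: firebrot_vertices_def)

lemma card_firebrot_vertices: "card firebrot_vertices = 4"
  by (simp add: firebrot_vertices_def vector_3_eq_iff)

lemma sum_firebrot_vertices:
  "sum f firebrot_vertices =
     f (vector [1/4, 1/4, 1/4]) + f (vector [1/4, -1/4, -1/4]) +
     f (vector [-1/4, 1/4, -1/4]) + f (vector [-1/4, -1/4, 1/4])"
  by (simp add: firebrot_vertices_def vector_3_eq_iff add.assoc)

lemma inner_firebrot_vertices:
  "\<lbrakk>v \<in> firebrot_vertices; w \<in> firebrot_vertices\<rbrakk> \<Longrightarrow> v \<bullet> w = (if v = w then 3 / 16 else - 1 / 16)"
  unfolding firebrot_vertices_def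
  by (elim insertE emptyE; hypsubst) (simp_all add: inner_real_3 vector_3_eq_iff)

lemma dist_firebrot_vertices:
  assumes "v \<in> firebrot_vertices" "w \<in> firebrot_vertices" "v \<noteq> w"
  shows "dist v w = sqrt 2 / 2"
proof -
  have "(dist v w)\<^sup>2 = v \<bullet> v - 2 * (v \<bullet> w) + w \<bullet> w"
    by (simp add: dist_norm power2_norm_eq_inner inner_diff inner_commute)
  also have "\<dots> = (sqrt 2 / 2)\<^sup>2"
    using assms by (simp add: inner_firebrot_vertices power_divide)
  finally show ?thesis
    by (simp add: power2_eq_iff_nonneg)
qed

text \<open>
  Pairing a vanishing affine combination with a vertex \<open>w\<close> isolates the coefficient of \<open>w\<close>,
  because all other vertices have the same inner product with \<open>w\<close>.
\<close>

lemma affine_independent_firebrot_vertices: "\<not> affine_dependent firebrot_vertices"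
proof
  assume "affine_dependent firebrot_vertices"
  then obtain u w where u: "sum u firebrot_vertices = 0" and w: "w \<in> firebrot_vertices" "u w \<noteq> 0"
    and comb: "(\<Sum>v\<in>firebrot_vertices. u v *\<^sub>R v) = 0"
    by (auto simp: affine_dependent_explicit_finite[OF finite_firebrot_vertices])
  have "0 = (\<Sum>v\<in>firebrot_vertices. u v *\<^sub>R v) \<bullet> w"
    by (simp add: comb)
  also have "\<dots> = (\<Sum>v\<in>firebrot_vertices. u v * (v \<bullet> w))"
    by (simp add: inner_sum_left)
  also have "\<dots> = (\<Sum>v\<in>firebrot_vertices. (if v = w then u v / 4 else 0) - u v / 16)"
    by (rule sum.cong) (simp_all add: inner_firebrot_vertices w)
  also have "\<dots> = u w / 4 - sum u firebrot_vertices / 16"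
    by (simp add: sum_subtractf sum_divide_distrib finite_firebrot_vertices w)
  finally show False
    using u w by simp
qed

text \<open>
  The vertices add up to \<open>0\<close> and \<open>\<Sum>v. (v \<bullet> p) v = p / 4\<close>, so that the numbers \<open>1/4 + 4 (v \<bullet> p)\<close>
  are the barycentric coordinates of \<open>p\<close>.
\<close>

lemma convex_hull_firebrot_vertices:
  "convex hull firebrot_vertices = {p. \<forall>v\<in>firebrot_vertices. - 1 / 16 \<le> v \<bullet> p}"
proof (rule subset_antisym)
  have "convex {p. \<forall>v\<in>firebrot_vertices. - 1 / 16 \<le> v \<bullet> p}"
  proof -
    have "{p. \<forall>v\<in>firebrot_vertices. - 1 / 16 \<le> v \<bullet> p} =
        (\<Inter>v\<in>firebrot_vertices. {p. v \<bullet> p \<ge> - 1 / 16})"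
      by auto
    then show ?thesis
      by (simp only: convex_INT convex_halfspace_ge)
  qed
  then show "convex hull firebrot_vertices \<subseteq> {p. \<forall>v\<in>firebrot_vertices. - 1 / 16 \<le> v \<bullet> p}"
    by (intro hull_minimal) (auto simp: inner_firebrot_vertices)
next
  show "{p. \<forall>v\<in>firebrot_vertices. - 1 / 16 \<le> v \<bullet> p} \<subseteq> convex hull firebrot_vertices"
  proof
    fix p assume "p \<in> {p. \<forall>v\<in>firebrot_vertices. - 1 / 16 \<le> v \<bullet> p}"
    then have "\<forall>v\<in>firebrot_vertices. 0 \<le> 1 / 4 + 4 * (v \<bullet> p)"
      by auto
    moreover have "(\<Sum>v\<in>firebrot_vertices. 1 / 4 + 4 * (v \<bullet> p)) = 1"
      by (simp add: sum_firebrot_vertices inner_real_3)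
    moreover have "(\<Sum>v\<in>firebrot_vertices. (1 / 4 + 4 * (v \<bullet> p)) *\<^sub>R v) = p"
      by (simp add: sum_firebrot_vertices inner_real_3 vec_eq_iff forall_3 algebra_simps)
    ultimately show "p \<in> convex hull firebrot_vertices"
      unfolding convex_hull_finite[OF finite_firebrot_vertices] by fast
  qed
qed

section \<open>The characters of the algebra generated by the hyperbolic units\<close>

lemma span_j_units: "span {j1, j2, j3} =
    {x. tc1 x = 0 \<and> tc2 x = 0 \<and> tc3 x = 0 \<and> tc5 x = 0 \<and> tc8 x = 0}"
  by (force simp: span_insert tricomplex_units tricomplex_eq_iff)

text \<open>
  The span of \<open>1\<close>, \<^term>\<open>j1\<close>, \<^term>\<open>j2\<close> and \<^term>\<open>j3\<close>. The unit \<open>1\<close> is included because squaring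
  leads out of the span of the other three.
\<close>

definition j_algebra :: "tricomplex set" where
  "j_algebra = {x. tc2 x = 0 \<and> tc3 x = 0 \<and> tc5 x = 0 \<and> tc8 x = 0}"

definition j_character :: "real ^ 3 \<Rightarrow> tricomplex \<Rightarrow> real" where
  "j_character v x = tc1 x - 4 * (v \<bullet> j_coords x)"

lemma zero_in_j_algebra: "0 \<in> j_algebra"
  by (simp add: j_algebra_def)

lemma j_algebra_quadratic: "\<lbrakk>x \<in> j_algebra; c \<in> j_algebra\<rbrakk> \<Longrightarrow> x\<^sup>2 + c \<in> j_algebra"
  by (simp add: j_algebra_def power2_eq_square)

lemma j_character_zero: "j_character v 0 = 0"
  by (simp add: j_character_def j_coords_def inner_real_3)

text \<open>
  A linear form on the algebra taking \<open>j1, j2, j3\<close> to \<open>- a, - b, - c\<close> with signs \<open>a, b, c\<close>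
  respects \<open>j1 j2 = - j3\<close> exactly if \<open>a b = c\<close>, and every vertex has coordinates
  \<open>a/4, b/4, c/4\<close> of this kind.
\<close>

lemma j_character_quadratic:
  assumes "v \<in> firebrot_vertices" "x \<in> j_algebra"
  shows "j_character v (x\<^sup>2 + c) = (j_character v x)\<^sup>2 + j_character v c"
  using assms unfolding firebrot_vertices_def
  by (elim insertE emptyE; hypsubst)
    (simp_all add: j_character_def j_algebra_def j_coords_def inner_real_3 power2_eq_square algebra_simps)

text \<open>Up to scaling, the four characters together are an isometry onto \<open>\<real>\<^sup>4\<close>.\<close>

lemma sum_j_character_squares:
  assumes "x \<in> j_algebra"
  shows "(\<Sum>v\<in>firebrot_vertices. (j_character v x)\<^sup>2) = 4 * (norm x)\<^sup>2"
  using assms unfolding power2_norm_eq_inner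
  by (simp add: sum_firebrot_vertices j_character_def j_algebra_def j_coords_def inner_real_3
      inner_tricomplex_def power2_eq_square algebra_simps)

lemma bounded_j_algebra_iff:
  assumes "S \<subseteq> j_algebra"
  shows "bounded S \<longleftrightarrow> (\<forall>v\<in>firebrot_vertices. bounded (j_character v ` S))"
proof
  assume "bounded S"
  then obtain B where B: "\<And>x. x \<in> S \<Longrightarrow> norm x \<le> B"
    by (auto simp: bounded_iff)
  show "\<forall>v\<in>firebrot_vertices. bounded (j_character v ` S)"
  proof
    fix v assume v: "v \<in> firebrot_vertices"
    have "\<bar>j_character v x\<bar> \<le> 2 * B" if "x \<in> S" for x
    proof -
      have "(j_character v x)\<^sup>2 \<le> (\<Sum>v\<in>firebrot_vertices. (j_character v x)\<^sup>2)"
        by (rule member_le_sum) (auto simp: v finite_firebrot_vertices)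
      also have "\<dots> = (2 * norm x)\<^sup>2"
        using that assms by (simp add: sum_j_character_squares subset_iff)
      finally have "\<bar>j_character v x\<bar> \<le> 2 * norm x"
        using abs_le_square_iff[of "j_character v x" "2 * norm x"] by simp
      with B[OF that] show ?thesis
        by linarith
    qed
    then show "bounded (j_character v ` S)"
      by (auto simp: bounded_iff)
  qed
next
  assume "\<forall>v\<in>firebrot_vertices. bounded (j_character v ` S)"
  then have "\<forall>v\<in>firebrot_vertices. \<exists>B. \<forall>x\<in>S. \<bar>j_character v x\<bar> \<le> B"
    by (simp add: bounded_iff)
  then obtain B where B: "\<And>v x. \<lbrakk>v \<in> firebrot_vertices; x \<in> S\<rbrakk> \<Longrightarrow> \<bar>j_character v x\<bar> \<le> B v"
    by metis
  have "norm x \<le> sqrt (\<Sum>v\<in>firebrot_vertices. (B v)\<^sup>2)" if "x \<in> S" for x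
  proof (rule real_le_rsqrt)
    have "(norm x)\<^sup>2 \<le> 4 * (norm x)\<^sup>2"
      by simp
    also have "\<dots> = (\<Sum>v\<in>firebrot_vertices. (j_character v x)\<^sup>2)"
      using that assms by (simp add: sum_j_character_squares subset_iff)
    also have "\<dots> \<le> (\<Sum>v\<in>firebrot_vertices. (B v)\<^sup>2)"
    proof (rule sum_mono)
      fix v assume "v \<in> firebrot_vertices"
      then show "(j_character v x)\<^sup>2 \<le> (B v)\<^sup>2"
        using power_mono[OF B[of v x], of 2] that by simp
    qed
    finally show "(norm x)\<^sup>2 \<le> (\<Sum>v\<in>firebrot_vertices. (B v)\<^sup>2)" .
  qed
  then show "bounded S"
    unfolding bounded_iff by blast
qed

section \<open>The Firebrot\<close>

lemma j_algebra_orbit: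
  assumes "c \<in> j_algebra"
  shows "((\<lambda>\<eta>. \<eta>\<^sup>2 + c) ^^ n) 0 \<in> j_algebra"
  by (induction n) (simp_all add: zero_in_j_algebra j_algebra_quadratic assms)

lemma j_character_orbit:
  assumes "v \<in> firebrot_vertices" "c \<in> j_algebra"
  shows "j_character v (((\<lambda>\<eta>. \<eta>\<^sup>2 + c) ^^ n) 0) = ((\<lambda>x. x\<^sup>2 + j_character v c) ^^ n) 0"
  by (induction n) (simp_all add: j_character_zero j_character_quadratic j_algebra_orbit assms)

lemma mandelbrot_j_algebra_iff:
  assumes "c \<in> j_algebra"
  shows "c \<in> tricomplex_mandelbrot \<longleftrightarrow>
    (\<forall>v\<in>firebrot_vertices. bounded (range (\<lambda>n. ((\<lambda>x. x\<^sup>2 + j_character v c) ^^ n) 0)))"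
proof -
  have "range (\<lambda>n. ((\<lambda>\<eta>. \<eta>\<^sup>2 + c) ^^ n) 0) \<subseteq> j_algebra"
    using j_algebra_orbit[OF assms] by blast
  then show ?thesis
    by (simp add: tricomplex_mandelbrot_def bounded_j_algebra_iff image_image
        j_character_orbit assms)
qed

lemma mandelbrot_j_span_iff:
  assumes "c \<in> span {j1, j2, j3}"
  shows "c \<in> tricomplex_mandelbrot \<longleftrightarrow> j_coords c \<in> convex hull firebrot_vertices"
proof -
  have c: "c \<in> j_algebra" and char: "j_character v c = - 4 * (v \<bullet> j_coords c)" for v
    using assms by (auto simp: span_j_units j_algebra_def j_character_def)
  have "c \<in> tricomplex_mandelbrot \<longleftrightarrow> (\<forall>v\<in>firebrot_vertices. j_character v c \<le> 1 / 4)"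
  proof
    assume "c \<in> tricomplex_mandelbrot"
    then show "\<forall>v\<in>firebrot_vertices. j_character v c \<le> 1 / 4"
      unfolding mandelbrot_j_algebra_iff[OF c]
      using real_quadratic_orbit_unbounded by (meson not_le)
  next
    assume le: "\<forall>v\<in>firebrot_vertices. j_character v c \<le> 1 / 4"
    \<comment> \<open>As the four parameters cancel, each is at least minus three times \<open>1/4\<close>.\<close>
    have total: "(\<Sum>v\<in>firebrot_vertices. j_character v c) = 0"
      by (simp add: char sum_firebrot_vertices inner_real_3)
    have "- 2 \<le> j_character v c" if v: "v \<in> firebrot_vertices" for v
    proof -
      have "(\<Sum>w\<in>firebrot_vertices - {v}. j_character w c) \<le> (\<Sum>w\<in>firebrot_vertices - {v}. 1 / 4)"
        using le by (intro sum_mono) auto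
      also have "\<dots> = 3 / 4"
        using v by (simp add: card_firebrot_vertices)
      finally show ?thesis
        using total sum.remove[OF finite_firebrot_vertices v, of "\<lambda>w. j_character w c"] by simp
    qed
    with le show "c \<in> tricomplex_mandelbrot"
      unfolding mandelbrot_j_algebra_iff[OF c] using real_quadratic_orbit_bounded by blast
  qed
  also have "\<dots> \<longleftrightarrow> j_coords c \<in> convex hull firebrot_vertices"
    unfolding convex_hull_firebrot_vertices mem_Collect_eq char
    by (rule ball_cong) auto
  finally show ?thesis .
qed

lemma j_coords_span_surj: "j_coords ` span {j1, j2, j3} = UNIV"
proof -
  have "p \<in> j_coords ` span {j1, j2, j3}" for p :: "real ^ 3"
  proof (rule image_eqI)
    show "p = j_coords (Tricomplex 0 0 0 (p $ 1) 0 (p $ 2) (p $ 3) 0)"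
      by (simp add: j_coords_def vec_eq_iff forall_3)
  qed (simp add: span_j_units)
  then show ?thesis
    by blast
qed

lemma firebrot_eq_convex_hull:
  "j_coords ` principal_slice j1 j2 j3 = convex hull firebrot_vertices"
proof -
  have "principal_slice j1 j2 j3 = span {j1, j2, j3} \<inter> j_coords -` (convex hull firebrot_vertices)"
    using mandelbrot_j_span_iff by (auto simp: principal_slice_def)
  moreover have "j_coords ` (span {j1, j2, j3} \<inter> j_coords -` H) = H" for H
  proof (rule subset_antisym)
    show "H \<subseteq> j_coords ` (span {j1, j2, j3} \<inter> j_coords -` H)"
    proof
      fix p assume "p \<in> H"
      moreover have "p \<in> j_coords ` span {j1, j2, j3}"
        by (simp add: j_coords_span_surj)
      ultimately show "p \<in> j_coords ` (span {j1, j2, j3} \<inter> j_coords -` H)"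
        by (elim imageE) simp
    qed
  qed blast
  ultimately show ?thesis
    by simp
qed

theorem theorem3:
  "regular_tetrahedron (sqrt 2 / 2) (j_coords ` principal_slice j1 j2 j3)"
  unfolding regular_tetrahedron_def
  using card_firebrot_vertices affine_independent_firebrot_vertices
    firebrot_eq_convex_hull dist_firebrot_vertices by blast

end
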